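(* Let $N\ge 2$, let $\Omega_0\subset\mathbb{R}^N$ be a bounded strictly convex domain, let $K>0$ be a constant and let $\varepsilon>0$. Then there exists a unique solution $u^\varepsilon$ to $$u^\varepsilon(x)=\sup_{A}\inf_{B}\left\{\frac{1}{\sigma(A\cap B)}\int_{A\cap B}u^\varepsilon(x+\varepsilon v)\,d\sigma(v)\right\}+\varepsilon^2K\quad\text{for }x\in\Omega_0,\qquad u^\varepsilon(x)=0\quad\text{for }x\in\mathbb{R}^N\setminus\Omega_0 .$$ Moreover, a comparison principle between supersolutions and subsolutions of this problem holds: if $\overline{u}^\varepsilon$ is a supersolution and $\underline{u}^\varepsilon$ is a subsolution, then $\overline{u}^\varepsilon(x)\ge\underline{u}^\varepsilon(x)$ for every $x\in\mathbb{R}^N$.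
   Context: $\sigma$ is the surface measure on the unit sphere $S^{N-1}\subset\mathbb{R}^N$, and $\delta_\varepsilon=\varepsilon^{1/2}$. Every supremum or infimum over sets $A$ or $B$ is taken over subsets of $S^{N-1}$ with surface measure greater than or equal to $\frac12\sigma(S^{N-1})+\delta_\varepsilon$ (slightly more than half of the sphere, so that $A\cap B$ has positive measure). The parameter $\varepsilon$ controls the size of the steps in an associated two-player game. A supersolution is a function $\overline{u}^\varepsilon$ with $\overline{u}^\varepsilon(x)\ge\sup_A\inf_B\{\frac{1}{\sigma(A\cap B)}\int_{A\cap B}\overline{u}^\varepsilon(x+\varepsilon v)\,d\sigma(v)\}+\varepsilon^2K$ for $x\in\Omega_0$ and $\overline{u}^\varepsilon(x)\ge0$ for $x\in\mathbb{R}^N\setminus\Omega_0$. A subsolution is a function $\underline{u}^\varepsilon$ for which the reverse inequalities hold, that is, $\underline{u}^\varepsilon(x)\le\sup_A\inf_B\{\frac{1}{\sigma(A\cap B)}\int_{A\cap B}\underline{u}^\varepsilon(x+\varepsilon v)\,d\sigma(v)\}+\varepsilon^2K$ for $x\in\Omega_0$ and $\underline{u}^\varepsilon(x)\le0$ for $x\in\mathbb{R}^N\setminus\Omega_0$. *)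

theory Defs
  imports "HOL-Analysis.Analysis"
begin

text \<open>
  Surface measure on the unit sphere, obtained from Lebesgue measure by polar coordinates:
  a Borel subset \<open>A\<close> of the sphere has measure \<open>N\<close> times the volume of the cone
  \<open>{r *\<^sub>R a | 0 < r < 1, a \<in> A}\<close>, which is the preimage of \<open>A\<close> under \<open>sgn x = x /\<^sub>R norm x\<close> in the
  punctured unit ball.  The factor \<open>N\<close> gives the usual (not the probability) normalisation, for
  example \<open>2 * pi\<close> for the circle; the threshold \<open>\<sigma>(S)/2 + \<delta>\<close> below depends on it.
\<close>

definition surface_measure :: "'a::euclidean_space measure" where
  "surface_measure =
     scale_measure (ennreal (real DIM('a)))
       (distr (restrict_space lborel (ball 0 1 - {0})) (restrict_space borel (sphere 0 1)) sgn)"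

lemma space_surface_measure [simp]:
  "space (surface_measure :: 'a::euclidean_space measure) = sphere 0 1"
  by (simp add: surface_measure_def space_scale_measure space_restrict_space)

lemma sets_surface_measure:
  "A \<in> sets (surface_measure :: 'a::euclidean_space measure) \<longleftrightarrow> A \<in> sets borel \<and> A \<subseteq> sphere 0 1"
  by (auto simp: surface_measure_def sets_restrict_space_iff)

lemma emeasure_surface_measure:
  fixes A :: "'a::euclidean_space set"
  assumes "A \<in> sets surface_measure"
  shows "emeasure surface_measure A
           = ennreal (real DIM('a)) * emeasure lborel {x \<in> ball 0 1 - {0}. sgn x \<in> A}"
proof -
  have sgn: "(sgn :: 'a \<Rightarrow> 'a) \<in> borel_measurable borel"
    unfolding sgn_div_norm by measurable
  have meas: "sgn \<in> restrict_space lborel (ball 0 1 - {0})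
                  \<rightarrow>\<^sub>M restrict_space borel (sphere (0::'a) 1)"
    by (intro measurable_restrict_space3) (use sgn in \<open>auto simp: norm_sgn\<close>)
  have A: "A \<in> sets (restrict_space borel (sphere 0 1))"
    using assms by (simp add: surface_measure_def)
  have vimage: "sgn -` A \<inter> space (restrict_space lborel (ball 0 1 - {0}))
                  = {x \<in> ball 0 1 - {0}. sgn x \<in> A}"
    by (auto simp: space_restrict_space)
  show ?thesis
    unfolding surface_measure_def emeasure_scale_measure emeasure_distr[OF meas A] vimage
    by (subst emeasure_restrict_space) auto
qed

lemma emeasure_surface_measure_sphere:
  "emeasure surface_measure (sphere (0::'a::euclidean_space) 1)
     = ennreal (real DIM('a) * unit_ball_vol (real DIM('a)))"
proof -
  have "{x \<in> ball 0 1 - {0}. sgn x \<in> sphere (0::'a) 1} = ball 0 1 - {0}"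
    by (auto simp: norm_sgn)
  moreover have "emeasure lborel (ball (0::'a) 1 - {0}) = emeasure lborel (ball (0::'a) 1)"
    by (rule emeasure_Diff_null_set) auto
  ultimately show ?thesis
    by (simp add: emeasure_surface_measure sets_surface_measure emeasure_ball ennreal_mult'')
qed

definition delta :: "real \<Rightarrow> real" where
  "delta \<epsilon> = sqrt \<epsilon>"

definition big_sets :: "real \<Rightarrow> 'a::euclidean_space set set" where
  "big_sets \<epsilon> =
     {A \<in> sets surface_measure.
        measure surface_measure A \<ge> measure surface_measure (sphere (0::'a) 1) / 2 + delta \<epsilon>}"

text \<open>
  Supremum and infimum are those of the conditionally complete lattice of the reals.  For the
  functions in \<open>loc_bdd_borel\<close> below, the averages over sets of measure at least
  \<open>2 * delta \<epsilon> > 0\<close> are uniformly bounded, so these are the true supremum and infimum whenever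
  \<open>big_sets \<epsilon>\<close> is nonempty.  It is empty only for \<open>\<epsilon>\<close> so large that
  \<open>delta \<epsilon>\<close> exceeds half the measure of the sphere; then \<open>game_value\<close> is the unspecified constant
  \<open>Sup {}\<close>.
\<close>

definition game_value :: "real \<Rightarrow> ('a::euclidean_space \<Rightarrow> real) \<Rightarrow> 'a \<Rightarrow> real" where
  "game_value \<epsilon> u x =
     (SUP A \<in> big_sets \<epsilon>. INF B \<in> big_sets \<epsilon>.
        1 / measure surface_measure (A \<inter> B)
          * set_lebesgue_integral surface_measure (A \<inter> B) (\<lambda>v. u (x + \<epsilon> *\<^sub>R v)))"

text \<open>
  The class of functions for which the spherical averages make sense.  Borel (rather than
  Lebesgue) measurability is needed because spheres are Lebesgue null sets.
\<close>

definition loc_bdd_borel :: "('a::euclidean_space \<Rightarrow> real) \<Rightarrow> bool" where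
  "loc_bdd_borel u \<longleftrightarrow> u \<in> borel_measurable borel \<and> (\<forall>S. bounded S \<longrightarrow> bounded (u ` S))"

definition solution :: "real \<Rightarrow> real \<Rightarrow> 'a::euclidean_space set \<Rightarrow> ('a \<Rightarrow> real) \<Rightarrow> bool" where
  "solution \<epsilon> K \<Omega> u \<longleftrightarrow> loc_bdd_borel u
     \<and> (\<forall>x\<in>\<Omega>. u x = game_value \<epsilon> u x + \<epsilon>\<^sup>2 * K) \<and> (\<forall>x. x \<notin> \<Omega> \<longrightarrow> u x = 0)"

definition supersolution :: "real \<Rightarrow> real \<Rightarrow> 'a::euclidean_space set \<Rightarrow> ('a \<Rightarrow> real) \<Rightarrow> bool" where
  "supersolution \<epsilon> K \<Omega> u \<longleftrightarrow> loc_bdd_borel u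
     \<and> (\<forall>x\<in>\<Omega>. u x \<ge> game_value \<epsilon> u x + \<epsilon>\<^sup>2 * K) \<and> (\<forall>x. x \<notin> \<Omega> \<longrightarrow> u x \<ge> 0)"

definition subsolution :: "real \<Rightarrow> real \<Rightarrow> 'a::euclidean_space set \<Rightarrow> ('a \<Rightarrow> real) \<Rightarrow> bool" where
  "subsolution \<epsilon> K \<Omega> u \<longleftrightarrow> loc_bdd_borel u
     \<and> (\<forall>x\<in>\<Omega>. u x \<le> game_value \<epsilon> u x + \<epsilon>\<^sup>2 * K) \<and> (\<forall>x. x \<notin> \<Omega> \<longrightarrow> u x \<le> 0)"

definition strictly_convex :: "'a::euclidean_space set \<Rightarrow> bool" where
  "strictly_convex S \<longleftrightarrow>
     (\<forall>x\<in>closure S. \<forall>y\<in>closure S. x \<noteq> y \<longrightarrow> open_segment x y \<subseteq> interior S)"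

end

theory Submission
  imports Defs
begin

text \<open>
  Write \<open>T u\<close> for the game value of \<open>u\<close>. The operator \<open>T\<close> is monotone, commutes with adding
  constants, and is positively homogeneous. These three properties give comparison. If \<open>w\<close> is a
  supersolution and \<open>l > 1\<close>, then \<open>l * w\<close> satisfies the supersolution inequality with the extra margin
  \<open>\<eta> = (l - 1) * \<epsilon>\<^sup>2 * K > 0\<close>. Hence a bound \<open>u \<le> l * w + c\<close> for a subsolution \<open>u\<close> improves itself to
  \<open>u \<le> l * w + max 0 (c - \<eta>)\<close>: inside the domain by applying \<open>T\<close>, outside by the signs of \<open>u\<close> and
  \<open>w\<close>. A finite number of improvements reaches \<open>c = 0\<close>, and \<open>l\<close> tends to 1. Uniqueness follows.

  Existence is by monotone iteration of \<open>u \<mapsto> T u + \<epsilon>\<^sup>2 * K\<close> on the domain, extended by 0, starting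
  at 0. Three points need an argument.

  \<^item> The iterates stay below a paraboloid \<open>C - K * |x|\<^sup>2\<close> on a ball that no single step from the
    domain leaves. The minimising player can answer a set
    \<open>A\<close> with its antipode \<open>- A\<close>, which has the same measure. The step is then uniform on a set that is
    symmetric about the origin, the linear term of \<open>|x + \<epsilon> v|\<^sup>2\<close> averages to zero, and each round
    costs \<open>\<epsilon>\<^sup>2 * K\<close>, exactly the running payoff (\<open>game_value_paraboloid_le\<close>).

  \<^item> A monotone limit does not in general commute with a supremum of infima. Here it does: two
    admissible sets always overlap in measure at least \<open>2 * \<delta>\<close>, so every average, and with it the
    sup-inf, is \<open>1 / (2 * \<delta>)\<close>-Lipschitz for the \<open>L\<^sup>1\<close> norm on the sphere. Dominated convergence
    finishes the argument (\<open>tendsto_sup_inf_mean\<close>).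

  \<^item> The iterates must stay Borel although the supremum and the infimum run over uncountable
    families. The averages depend continuously on the two sets, in the pseudometric given by the measure
    of the symmetric difference. This pseudometric is separable, so countable dense subfamilies give
    the same value (\<open>sup_inf_mean_dense\<close>, \<open>borel_measurable_game_value\<close>).

  If \<open>\<epsilon>\<close> is so large that no set is admissible, \<open>T u\<close> is a constant independent of \<open>u\<close>, and both
  claims can be read off.
\<close>

section \<open>Values of two-player games on a matrix of reals\<close>

text \<open>
  Copying strategies: a move \<open>i\<close> in the first game is imitated by a move \<open>i'\<close> in the second
  one, and every answer \<open>j'\<close> there is imitated by an answer \<open>j\<close> here. Every comparison of game values
  below (monotonicity, scaling, stability in the payoff and in the families of moves) is an instance.
\<close>

lemma sup_inf_le_affine:
  fixes a :: "'i \<Rightarrow> 'j \<Rightarrow> real" and b :: "'k \<Rightarrow> 'l \<Rightarrow> real"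
  assumes ne: "I \<noteq> {}" "J' \<noteq> {}"
    and bdd_a: "\<And>i j. i \<in> I \<Longrightarrow> j \<in> J \<Longrightarrow> \<bar>a i j\<bar> \<le> C"
    and bdd_b: "\<And>i j. i \<in> I' \<Longrightarrow> j \<in> J' \<Longrightarrow> \<bar>b i j\<bar> \<le> C'"
    and "l > 0"
    and reply: "\<And>i. i \<in> I \<Longrightarrow> \<exists>i'\<in>I'. \<forall>j'\<in>J'. \<exists>j\<in>J. a i j \<le> l * b i' j' + c"
  shows "(SUP i\<in>I. INF j\<in>J. a i j) \<le> l * (SUP i\<in>I'. INF j\<in>J'. b i j) + c"
proof (rule cSUP_least[OF ne(1)])
  fix i assume i: "i \<in> I"
  obtain i' where i': "i' \<in> I'" and r: "\<And>j'. j' \<in> J' \<Longrightarrow> \<exists>j\<in>J. a i j \<le> l * b i' j' + c"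
    using reply[OF i] by blast
  have below_a: "bdd_below (a i ` J)"
    using bdd_a[OF i] by (intro bdd_belowI2[where m = "- C"]) (auto simp: abs_le_iff minus_le_iff)
  have below_b: "bdd_below (b k ` J')" if "k \<in> I'" for k
    using bdd_b[OF that] by (intro bdd_belowI2[where m = "- C'"]) (auto simp: abs_le_iff minus_le_iff)
  have "(INF j\<in>J. a i j) \<le> l * b i' j' + c" if "j' \<in> J'" for j'
    using r[OF that] cINF_lower[OF below_a] by (meson order_trans)
  then have "((INF j\<in>J. a i j) - c) / l \<le> (INF j\<in>J'. b i' j)"
    using \<open>l > 0\<close> by (intro cINF_greatest[OF ne(2)]) (simp add: field_simps)
  also have "\<dots> \<le> (SUP i\<in>I'. INF j\<in>J'. b i j)"
  proof (rule cSUP_upper[OF i'])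
    obtain j0 where j0: "j0 \<in> J'" using ne(2) by blast
    have "(INF j\<in>J'. b k j) \<le> C'" if "k \<in> I'" for k
      using cINF_lower[OF below_b[OF that] j0] bdd_b[OF that j0] by linarith
    then show "bdd_above ((\<lambda>i. INF j\<in>J'. b i j) ` I')"
      by (rule bdd_aboveI2)
  qed
  finally show "(INF j\<in>J. a i j) \<le> l * (SUP i\<in>I'. INF j\<in>J'. b i j) + c"
    using \<open>l > 0\<close> by (simp add: field_simps)
qed

section \<open>Averages of bounded functions\<close>

definition bounded_measurable :: "'a measure \<Rightarrow> ('a \<Rightarrow> real) \<Rightarrow> bool" where
  "bounded_measurable M f \<longleftrightarrow> f \<in> borel_measurable M \<and> bounded (f ` space M)"

definition mean_on :: "'a measure \<Rightarrow> 'a set \<Rightarrow> ('a \<Rightarrow> real) \<Rightarrow> real" where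
  "mean_on M C f = 1 / measure M C * (LINT v:C|M. f v)"

lemma bounded_measurableI:
  assumes "f \<in> borel_measurable M" "\<And>v. v \<in> space M \<Longrightarrow> \<bar>f v\<bar> \<le> b"
  shows "bounded_measurable M f"
  using assms unfolding bounded_measurable_def bounded_iff by auto

lemma bounded_measurableE:
  assumes "bounded_measurable M f"
  obtains b where "b \<ge> 0" "\<And>v. v \<in> space M \<Longrightarrow> \<bar>f v\<bar> \<le> b"
proof -
  obtain b where "\<forall>v\<in>space M. \<bar>f v\<bar> \<le> b"
    using assms unfolding bounded_measurable_def bounded_iff by auto
  then have "0 \<le> max b 0" "\<And>v. v \<in> space M \<Longrightarrow> \<bar>f v\<bar> \<le> max b 0" by fastforce+
  then show thesis by (rule that)
qed

context finite_measure
begin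

lemma set_integrable_bounded_measurable:
  assumes "bounded_measurable M f" "C \<in> sets M"
  shows "set_integrable M C f"
proof -
  obtain b where b: "\<And>v. v \<in> space M \<Longrightarrow> \<bar>f v\<bar> \<le> b"
    using assms(1) by (metis bounded_measurableE)
  have "integrable M f"
    by (rule integrable_const_bound[where B = b])
       (use assms b in \<open>auto simp: bounded_measurable_def\<close>)
  then show ?thesis
    unfolding set_integrable_def using assms(2) by (rule integrable_mult_indicator[rotated])
qed

lemma set_integrable_const: "C \<in> sets M \<Longrightarrow> set_integrable M C (\<lambda>_. c :: real)"
  by (rule set_integrable_bounded_measurable, rule bounded_measurableI[where b = "\<bar>c\<bar>"]) auto

lemma mean_on_le_affine:
  assumes f: "bounded_measurable M f" and g: "bounded_measurable M g"
    and C: "C \<in> sets M" "measure M C > 0"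
    and le: "\<And>v. v \<in> C \<Longrightarrow> f v \<le> l * g v + c"
  shows "mean_on M C f \<le> l * mean_on M C g + c"
proof -
  note [simp] = set_integrable_bounded_measurable[OF f C(1)]
    set_integrable_bounded_measurable[OF g C(1)] set_integrable_const[OF C(1)]
  have "(LINT v:C|M. f v) \<le> (LINT v:C|M. l * g v + c)"
    by (rule set_integral_mono) (auto intro!: set_integral_add simp: le)
  also have "\<dots> = l * (LINT v:C|M. g v) + measure M C * c"
    using C by (subst set_integral_add) (auto simp: set_lebesgue_integral_def)
  finally show ?thesis
    using C(2) unfolding mean_on_def by (simp add: field_simps)
qed

lemma abs_mean_on_le:
  assumes f: "bounded_measurable M f" and C: "C \<in> sets M" "measure M C > 0"
    and le: "\<And>v. v \<in> C \<Longrightarrow> \<bar>f v\<bar> \<le> b"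
  shows "\<bar>mean_on M C f\<bar> \<le> b"
proof -
  have z: "bounded_measurable M (\<lambda>_. - b)" "bounded_measurable M (\<lambda>_. 0)"
    by (auto intro: bounded_measurableI)
  have "mean_on M C f \<le> 0 * mean_on M C (\<lambda>_. 0) + b"
    by (rule mean_on_le_affine[OF f z(2) C]) (use le in \<open>auto simp: abs_le_iff\<close>)
  moreover have "0 \<le> 1 * mean_on M C f + b"
    using mean_on_le_affine[OF z(2) f C, of 1 b] le
    by (force simp: mean_on_def set_lebesgue_integral_def abs_le_iff)
  ultimately show ?thesis by (simp add: abs_le_iff)
qed

text \<open>
  The constant \<open>1 / d\<close> is the same for all sets, so the estimate survives a supremum of infima over
  them.
\<close>

lemma mean_on_le_mean_on_plus_L1:
  assumes f: "bounded_measurable M f" and g: "bounded_measurable M g"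
    and C: "C \<in> sets M" "d \<le> measure M C" and "d > 0"
  shows "mean_on M C f \<le> mean_on M C g + (LINT v|M. \<bar>f v - g v\<bar>) / d"
proof -
  have fg: "bounded_measurable M (\<lambda>v. \<bar>f v - g v\<bar>)"
  proof -
    obtain a b where ab: "\<And>v. v \<in> space M \<Longrightarrow> \<bar>f v\<bar> \<le> a" "\<And>v. v \<in> space M \<Longrightarrow> \<bar>g v\<bar> \<le> b"
      using f g by (metis bounded_measurableE)
    have m: "f \<in> borel_measurable M" "g \<in> borel_measurable M"
      using f g by (auto simp: bounded_measurable_def)
    show ?thesis
    proof (rule bounded_measurableI)
      show "(\<lambda>v. \<bar>f v - g v\<bar>) \<in> borel_measurable M" using m by measurable
      show "\<bar>\<bar>f v - g v\<bar>\<bar> \<le> a + b" if "v \<in> space M" for v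
        using ab[OF that] by linarith
    qed
  qed
  note si = set_integrable_bounded_measurable
  have Cpos: "measure M C > 0" using C \<open>d > 0\<close> by linarith
  have "(LINT v:C|M. f v) \<le> (LINT v:C|M. g v + \<bar>f v - g v\<bar>)"
    by (rule set_integral_mono) (auto intro!: set_integral_add(1) si[OF f] si[OF g] si[OF fg] C)
  also have "\<dots> = (LINT v:C|M. g v) + (LINT v:C|M. \<bar>f v - g v\<bar>)"
    by (rule set_integral_add(2)) (auto intro!: si f g fg C)
  also have "(LINT v:C|M. \<bar>f v - g v\<bar>) \<le> (LINT v|M. \<bar>f v - g v\<bar>)"
    unfolding set_lebesgue_integral_def
  proof (rule integral_mono)
    show "integrable M (\<lambda>v. indicat_real C v *\<^sub>R \<bar>f v - g v\<bar>)"
      using si[OF fg C(1)] by (simp add: set_integrable_def)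
    have "set_integrable M (space M) (\<lambda>v. \<bar>f v - g v\<bar>)" by (rule si[OF fg]) simp
    then show "integrable M (\<lambda>v. \<bar>f v - g v\<bar>)"
      unfolding set_integrable_def by (simp cong: Bochner_Integration.integrable_cong)
  qed (auto simp: indicator_def)
  finally have "mean_on M C f \<le> mean_on M C g + (LINT v|M. \<bar>f v - g v\<bar>) / measure M C"
    using Cpos unfolding mean_on_def by (simp add: field_simps)
  also have "(LINT v|M. \<bar>f v - g v\<bar>) / measure M C \<le> (LINT v|M. \<bar>f v - g v\<bar>) / d"
    using C \<open>d > 0\<close> by (intro divide_left_mono) (auto intro: mult_pos_pos Cpos)
  finally show ?thesis by simp
qed

text \<open>
  Both the integral and the measure change by at most a multiple of the measure of the symmetric
  difference, and the measures in the denominators are at least \<open>d\<close>.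
\<close>

lemma mean_on_le_mean_on_plus_sym_diff:
  assumes f: "bounded_measurable M f" and b: "\<And>v. v \<in> space M \<Longrightarrow> \<bar>f v\<bar> \<le> b"
    and C: "C \<in> sets M" "d \<le> measure M C" and D: "D \<in> sets M" "d \<le> measure M D" and "d > 0"
  shows "mean_on M C f \<le> mean_on M D f + 2 * b / d * measure M (sym_diff C D)"
proof -
  let ?S = "sym_diff C D"
  have S: "?S \<in> sets M" using C D by auto
  have pos: "measure M C > 0" "measure M D > 0" using C D \<open>d > 0\<close> by linarith+
  have int: "integrable M (\<lambda>v. indicator A v * f v)" if "A \<in> sets M" for A
    using set_integrable_bounded_measurable[OF f that] by (simp add: set_integrable_def)
  have L: "(LINT v:A|M. f v) = (LINT v|M. indicator A v * f v)" for A
    by (simp add: set_lebesgue_integral_def)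
  have I: "(LINT v:C|M. f v) - (LINT v:D|M. f v) \<le> b * measure M ?S"
  proof -
    have "(LINT v:C|M. f v) - (LINT v:D|M. f v) = (LINT v|M. indicator C v * f v - indicator D v * f v)"
      unfolding L by (rule Bochner_Integration.integral_diff[symmetric]) (use int C D in auto)
    also have "\<dots> \<le> (LINT v|M. indicator ?S v * b)"
    proof (rule integral_mono)
      show "integrable M (\<lambda>v. indicator C v * f v - indicator D v * f v)"
        using int C D by (intro Bochner_Integration.integrable_diff) auto
      show "integrable M (\<lambda>v. indicator ?S v * b)"
        using set_integrable_const[OF S, of b] by (simp add: set_integrable_def)
      fix v assume "v \<in> space M"
      then show "indicator C v * f v - indicator D v * f v \<le> indicator ?S v * b"
        using b[of v] by (auto simp: indicator_def abs_le_iff)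
    qed
    also have "\<dots> = b * measure M ?S" using S by simp
    finally show ?thesis .
  qed
  have m: "measure M D - measure M C \<le> measure M ?S" "measure M C - measure M D \<le> measure M ?S"
  proof -
    have "measure M D \<le> measure M (C \<union> ?S)" "measure M C \<le> measure M (D \<union> ?S)"
      by (auto intro!: finite_measure_mono C D)
    moreover have "measure M (C \<union> ?S) \<le> measure M C + measure M ?S"
      "measure M (D \<union> ?S) \<le> measure M D + measure M ?S"
      by (auto intro!: measure_Un_le C D)
    ultimately show "measure M D - measure M C \<le> measure M ?S" "measure M C - measure M D \<le> measure M ?S"
      by linarith+
  qed
  have D_le: "\<bar>mean_on M D f\<bar> \<le> b"
    using abs_mean_on_le[OF f D(1) pos(2)] b sets.sets_into_space[OF D(1)] by blast
  \<comment> \<open>The change of the denominator is weighted by the average over \<open>D\<close>, which is at most \<open>b\<close> in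
    absolute value; this avoids products of two denominators.\<close>
  have "measure M C * (mean_on M C f - mean_on M D f)
      = ((LINT v:C|M. f v) - (LINT v:D|M. f v)) + mean_on M D f * (measure M D - measure M C)"
    using pos unfolding mean_on_def by (simp add: field_simps)
  also have "mean_on M D f * (measure M D - measure M C) \<le> \<bar>mean_on M D f\<bar> * \<bar>measure M D - measure M C\<bar>"
    by (metis abs_ge_self abs_mult)
  also have "\<dots> \<le> b * measure M ?S"
    using D_le m by (intro mult_mono) auto
  finally have "measure M C * (mean_on M C f - mean_on M D f) \<le> 2 * b * measure M ?S"
    using I by linarith
  then have "mean_on M C f - mean_on M D f \<le> 2 * b * measure M ?S / measure M C"
    using pos by (simp add: field_simps)
  also have "\<dots> \<le> 2 * b * measure M ?S / d"
    using C \<open>d > 0\<close> pos D_le by (intro divide_left_mono) (auto intro!: mult_nonneg_nonneg)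
  finally show ?thesis by simp
qed

end

section \<open>The value for a family of sets with large pairwise intersections\<close>

definition sup_inf_mean :: "'a measure \<Rightarrow> 'a set set \<Rightarrow> ('a \<Rightarrow> real) \<Rightarrow> real" where
  "sup_inf_mean M \<F> f = (SUP A\<in>\<F>. INF B\<in>\<F>. mean_on M (A \<inter> B) f)"

locale overlapping_family = finite_measure M for M :: "'a measure" +
  fixes \<F> :: "'a set set" and d :: real
  assumes nonempty: "\<F> \<noteq> {}"
    and sets: "\<F> \<subseteq> sets M"
    and d_pos: "d > 0"
    and overlap: "\<And>A B. A \<in> \<F> \<Longrightarrow> B \<in> \<F> \<Longrightarrow> d \<le> measure M (A \<inter> B)"
begin

lemma inter_sets: "A \<in> \<F> \<Longrightarrow> B \<in> \<F> \<Longrightarrow> A \<inter> B \<in> sets M"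
  using sets by auto

lemma inter_pos: "A \<in> \<F> \<Longrightarrow> B \<in> \<F> \<Longrightarrow> 0 < measure M (A \<inter> B)"
  using overlap d_pos by fastforce

lemma abs_mean_on_inter_le:
  assumes "bounded_measurable M f" "\<And>v. v \<in> space M \<Longrightarrow> \<bar>f v\<bar> \<le> b" "A \<in> \<F>" "B \<in> \<F>"
  shows "\<bar>mean_on M (A \<inter> B) f\<bar> \<le> b"
  using assms sets.sets_into_space[OF inter_sets[OF assms(3,4)]]
  by (intro abs_mean_on_le inter_sets inter_pos) auto

text \<open>
  The families of moves may be different subfamilies on the two sides, which is what passing to a
  dense subfamily requires.
\<close>

lemma sup_inf_mean_le_affineI:
  assumes f: "bounded_measurable M f" and g: "bounded_measurable M g"
    and \<G>: "\<G> \<subseteq> \<F>" "\<G> \<noteq> {}" and \<H>: "\<H> \<subseteq> \<F>" "\<H> \<noteq> {}" and "l > 0"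
    and reply: "\<And>A. A \<in> \<G> \<Longrightarrow>
      \<exists>A'\<in>\<H>. \<forall>B'\<in>\<H>. \<exists>B\<in>\<G>. mean_on M (A \<inter> B) f \<le> l * mean_on M (A' \<inter> B') g + c"
  shows "sup_inf_mean M \<G> f \<le> l * sup_inf_mean M \<H> g + c"
proof -
  obtain a b where ab: "\<And>v. v \<in> space M \<Longrightarrow> \<bar>f v\<bar> \<le> a" "\<And>v. v \<in> space M \<Longrightarrow> \<bar>g v\<bar> \<le> b"
    using f g by (metis bounded_measurableE)
  show ?thesis
    unfolding sup_inf_mean_def
    by (rule sup_inf_le_affine[where C = a and C' = b])
       (use \<G> \<H> reply \<open>l > 0\<close> abs_mean_on_inter_le[OF f ab(1)] abs_mean_on_inter_le[OF g ab(2)] in blast)+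
qed

text \<open>
  Monotonicity, translation and positive homogeneity in one inequality.
\<close>

lemma sup_inf_mean_le_affine:
  assumes f: "bounded_measurable M f" and g: "bounded_measurable M g" and "l > 0"
    and le: "\<And>v. v \<in> space M \<Longrightarrow> f v \<le> l * g v + c"
  shows "sup_inf_mean M \<F> f \<le> l * sup_inf_mean M \<F> g + c"
proof (rule sup_inf_mean_le_affineI[OF f g _ nonempty _ nonempty \<open>l > 0\<close>])
  have "mean_on M (A \<inter> B) f \<le> l * mean_on M (A \<inter> B) g + c" if "A \<in> \<F>" "B \<in> \<F>" for A B
    using le sets.sets_into_space[OF inter_sets[OF that]]
    by (intro mean_on_le_affine[OF f g] inter_sets inter_pos that) auto
  then show "\<exists>A'\<in>\<F>. \<forall>B'\<in>\<F>. \<exists>B\<in>\<F>. mean_on M (A \<inter> B) f \<le> l * mean_on M (A' \<inter> B') g + c"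
    if "A \<in> \<F>" for A using that by blast
qed auto

lemma sup_inf_mean_le_plus_L1:
  assumes f: "bounded_measurable M f" and g: "bounded_measurable M g"
  shows "sup_inf_mean M \<F> f \<le> sup_inf_mean M \<F> g + (LINT v|M. \<bar>f v - g v\<bar>) / d"
proof -
  have "sup_inf_mean M \<F> f \<le> 1 * sup_inf_mean M \<F> g + (LINT v|M. \<bar>f v - g v\<bar>) / d"
  proof (rule sup_inf_mean_le_affineI[OF f g _ nonempty _ nonempty])
    show "\<exists>A'\<in>\<F>. \<forall>B'\<in>\<F>. \<exists>B\<in>\<F>.
        mean_on M (A \<inter> B) f \<le> 1 * mean_on M (A' \<inter> B') g + (LINT v|M. \<bar>f v - g v\<bar>) / d"
      if "A \<in> \<F>" for A
      using that mean_on_le_mean_on_plus_L1[OF f g inter_sets overlap d_pos] by auto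
  qed auto
  then show ?thesis by simp
qed

text \<open>
  Dominated convergence turns pointwise convergence into \<open>L\<^sup>1\<close> convergence, for which the value is
  Lipschitz.
\<close>

lemma tendsto_sup_inf_mean:
  assumes f: "\<And>n. f n \<in> borel_measurable M" "\<And>n v. v \<in> space M \<Longrightarrow> \<bar>f n v\<bar> \<le> b"
    and lim: "\<And>v. v \<in> space M \<Longrightarrow> (\<lambda>n. f n v) \<longlonglongrightarrow> g v"
  shows "(\<lambda>n. sup_inf_mean M \<F> (f n)) \<longlonglongrightarrow> sup_inf_mean M \<F> g"
proof -
  have g: "g \<in> borel_measurable M"
    by (rule borel_measurable_LIMSEQ_real[OF lim f(1)])
  have gb: "\<bar>g v\<bar> \<le> b" if "v \<in> space M" for v
    by (rule LIMSEQ_le_const2[OF tendsto_rabs[OF lim[OF that]]]) (use f(2) that in auto)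
  have bm: "bounded_measurable M (f n)" "bounded_measurable M g" for n
    by (rule bounded_measurableI[of _ _ b], use f g gb in auto)+
  have "(\<lambda>n. LINT v|M. \<bar>f n v - g v\<bar>) \<longlonglongrightarrow> (LINT v|M. 0)"
  proof (rule integral_dominated_convergence[where w = "\<lambda>_. 2 * b"])
    show "AE v in M. (\<lambda>n. \<bar>f n v - g v\<bar>) \<longlonglongrightarrow> 0"
      using lim by (intro AE_I2) (auto intro!: tendsto_rabs_zero simp: LIM_zero_iff)
    show "AE v in M. norm \<bar>f n v - g v\<bar> \<le> 2 * b" for n
    proof (intro AE_I2)
      fix v assume "v \<in> space M"
      then show "norm \<bar>f n v - g v\<bar> \<le> 2 * b" using f(2)[of v n] gb[of v] by simp
    qed
  qed (use f(1) g in \<open>auto\<close>)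
  then have lim0: "(\<lambda>n. (LINT v|M. \<bar>f n v - g v\<bar>) / d) \<longlonglongrightarrow> 0"
    by (auto intro!: tendsto_eq_intros simp: d_pos less_imp_neq[symmetric])
  have "\<bar>sup_inf_mean M \<F> (f n) - sup_inf_mean M \<F> g\<bar> \<le> (LINT v|M. \<bar>f n v - g v\<bar>) / d" for n
    using sup_inf_mean_le_plus_L1[OF bm(1)[of n] bm(2)] sup_inf_mean_le_plus_L1[OF bm(2) bm(1)[of n]]
    by (simp add: abs_le_iff abs_minus_commute)
  then show ?thesis
    by (intro LIM_zero_cancel[OF Lim_null_comparison[OF _ lim0]]) simp
qed

text \<open>
  A restricted player who approximates the intended set changes the average by as little as desired,
  uniformly in the set chosen by the opponent. So each restriction costs nothing in the limit.
\<close>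

lemma sup_inf_mean_dense:
  assumes f: "bounded_measurable M f" and \<D>: "\<D> \<subseteq> \<F>" "\<D> \<noteq> {}"
    and dense: "\<And>A e. A \<in> \<F> \<Longrightarrow> e > 0 \<Longrightarrow> \<exists>D\<in>\<D>. measure M (sym_diff A D) < e"
  shows "sup_inf_mean M \<F> f = sup_inf_mean M \<D> f"
proof -
  obtain b where b: "b \<ge> 0" "\<And>v. v \<in> space M \<Longrightarrow> \<bar>f v\<bar> \<le> b"
    using f by (metis bounded_measurableE)
  have close: "mean_on M (A \<inter> B) f
      \<le> mean_on M (A' \<inter> B') f + 2 * b / d * (measure M (sym_diff A A') + measure M (sym_diff B B'))"
    if "A \<in> \<F>" "B \<in> \<F>" "A' \<in> \<F>" "B' \<in> \<F>" for A B A' B'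
  proof -
    have s: "A \<in> sets M" "B \<in> sets M" "A' \<in> sets M" "B' \<in> sets M" using that sets by auto
    have "measure M (sym_diff (A \<inter> B) (A' \<inter> B')) \<le> measure M (sym_diff A A' \<union> sym_diff B B')"
      using s by (intro finite_measure_mono) auto
    also have "\<dots> \<le> measure M (sym_diff A A') + measure M (sym_diff B B')"
      using s by (intro measure_Un_le) auto
    finally have "2 * b / d * measure M (sym_diff (A \<inter> B) (A' \<inter> B'))
        \<le> 2 * b / d * (measure M (sym_diff A A') + measure M (sym_diff B B'))"
      using b d_pos by (intro mult_left_mono) auto
    then show ?thesis
      using mean_on_le_mean_on_plus_sym_diff[OF f b(2) inter_sets[OF that(1,2)] overlap[OF that(1,2)]
          inter_sets[OF that(3,4)] overlap[OF that(3,4)] d_pos] by linarith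
  qed
  have near: "\<exists>D\<in>\<D>. 2 * b / d * measure M (sym_diff A D) \<le> e" if "A \<in> \<F>" "e > 0" for A e
  proof -
    \<comment> \<open>The summand 1 covers \<open>b = 0\<close>.\<close>
    have pos: "e * d / (2 * b + 1) > 0" using that b d_pos by simp
    obtain D where D: "D \<in> \<D>" "measure M (sym_diff A D) < e * d / (2 * b + 1)"
      using dense[OF \<open>A \<in> \<F>\<close> pos] by blast
    have "2 * b / d * measure M (sym_diff A D) \<le> 2 * b / d * (e * d / (2 * b + 1))"
      using D(2) b d_pos by (intro mult_left_mono) auto
    also have "\<dots> \<le> e" using b d_pos that by (simp add: field_simps)
    finally show ?thesis using D(1) by blast
  qed
  show ?thesis
  proof (rule antisym; rule field_le_epsilon)
    fix e :: real assume "e > 0"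
    have "sup_inf_mean M \<F> f \<le> 1 * sup_inf_mean M \<D> f + e"
    proof (rule sup_inf_mean_le_affineI[OF f f order_refl nonempty \<D>])
      fix A assume A: "A \<in> \<F>"
      obtain A' where A': "A' \<in> \<D>" "2 * b / d * measure M (sym_diff A A') \<le> e"
        using near[OF A \<open>e > 0\<close>] by blast
      have "mean_on M (A \<inter> B) f \<le> 1 * mean_on M (A' \<inter> B) f + e" if "B \<in> \<D>" for B
      proof -
        have "A' \<in> \<F>" "B \<in> \<F>" using A' that \<D> by auto
        then show ?thesis using close[OF A _ \<open>A' \<in> \<F>\<close>, of B B] A' by simp
      qed
      then show "\<exists>A'\<in>\<D>. \<forall>B'\<in>\<D>. \<exists>B\<in>\<F>. mean_on M (A \<inter> B) f \<le> 1 * mean_on M (A' \<inter> B') f + e"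
        using A' \<D> by blast
    qed simp
    then show "sup_inf_mean M \<F> f \<le> sup_inf_mean M \<D> f + e" by simp
    have "sup_inf_mean M \<D> f \<le> 1 * sup_inf_mean M \<F> f + e"
    proof (rule sup_inf_mean_le_affineI[OF f f \<D> order_refl nonempty])
      fix A assume A: "A \<in> \<D>"
      have "\<exists>B\<in>\<D>. mean_on M (A \<inter> B) f \<le> 1 * mean_on M (A \<inter> B') f + e" if B': "B' \<in> \<F>" for B'
      proof -
        obtain B where B: "B \<in> \<D>" "2 * b / d * measure M (sym_diff B' B) \<le> e"
          using near[OF B' \<open>e > 0\<close>] by blast
        have "A \<in> \<F>" "B \<in> \<F>" using A B \<D> by auto
        then show ?thesis
          using close[OF \<open>A \<in> \<F>\<close> \<open>B \<in> \<F>\<close> \<open>A \<in> \<F>\<close> B'] B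
          by (intro bexI[of _ B]) (simp_all add: Un_commute)
      qed
      then show "\<exists>A'\<in>\<F>. \<forall>B'\<in>\<F>. \<exists>B\<in>\<D>. mean_on M (A \<inter> B) f \<le> 1 * mean_on M (A' \<inter> B') f + e"
        using A \<D> by blast
    qed simp
    then show "sup_inf_mean M \<D> f \<le> sup_inf_mean M \<F> f + e" by simp
  qed
qed

end

section \<open>Countable dense families of Borel sets\<close>

text \<open>
  Finite unions of basic open sets are dense: by outer regularity a Borel set is close to an open
  set, and an open set is the increasing limit of such finite unions.
\<close>

lemma countable_dense_borel_sets:
  fixes M :: "'a::{second_countable_topology, complete_space} measure"
  assumes "finite_measure M" and sets: "sets M = sets borel"
  obtains \<C> where "countable \<C>" "\<C> \<subseteq> sets M"
    "\<And>A e. A \<in> sets M \<Longrightarrow> e > 0 \<Longrightarrow> \<exists>C\<in>\<C>. measure M (sym_diff A C) < e"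
proof -
  interpret finite_measure M by fact
  obtain \<B> :: "'a set set" where \<B>: "countable \<B>" "topological_basis \<B>"
    using ex_countable_basis by blast
  have open_sets: "open U \<Longrightarrow> U \<in> sets M" for U using sets by simp
  define \<C> where "\<C> = Union ` {\<A>. finite \<A> \<and> \<A> \<subseteq> \<B>}"
  show thesis
  proof (rule that[of \<C>])
    show "countable \<C>"
      unfolding \<C>_def using \<B>(1) by (intro countable_image countable_Collect_finite_subset)
    show "\<C> \<subseteq> sets M"
      unfolding \<C>_def using \<B>(2) by (auto intro!: open_sets open_Union dest: topological_basis_open)
    fix A and e :: real assume A: "A \<in> sets M" and "e > 0"
    have "emeasure M A = (INF U\<in>{U. A \<subseteq> U \<and> open U}. emeasure M U)"
      using sets A by (intro outer_regular) auto
    moreover have "emeasure M A < emeasure M A + ennreal (e / 2)"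
      using \<open>e > 0\<close>
      by (simp add: emeasure_eq_measure ennreal_plus[symmetric] ennreal_less_iff del: ennreal_plus)
    ultimately obtain U where U: "A \<subseteq> U" "open U" "emeasure M U < emeasure M A + ennreal (e / 2)"
      by (auto simp: INF_less_iff)
    have "measure M U < measure M A + e / 2"
      using U(3) \<open>e > 0\<close>
      by (simp add: emeasure_eq_measure ennreal_plus[symmetric] ennreal_less_iff del: ennreal_plus)
    moreover have "measure M (U - A) = measure M U - measure M A"
      using A U open_sets by (intro finite_measure_Diff) auto
    ultimately have UA: "measure M (U - A) < e / 2" by linarith
    obtain \<A> where \<A>: "\<A> \<subseteq> \<B>" "\<Union>\<A> = U"
      using \<B>(2) U(2) unfolding topological_basis_def by blast
    show "\<exists>C\<in>\<C>. measure M (sym_diff A C) < e"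
    proof (cases "\<A> = {}")
      case True
      then have "A = {}" using U \<A> by auto
      then show ?thesis
        using \<open>e > 0\<close> by (intro bexI[of _ "{}"]) (auto simp: \<C>_def intro!: image_eqI[of _ _ "{}"])
    next
      case False
      define b where "b = from_nat_into \<A>"
      have ran: "range b = \<A>"
        unfolding b_def using False \<A> \<B>(1) countable_subset by (intro range_from_nat_into) auto
      define V where "V n = \<Union>(b ` {..n})" for n
      have V_sets: "V n \<in> sets M" for n
      proof -
        have "open (b k)" for k
          using ran \<A>(1) topological_basis_open[OF \<B>(2)] by blast
        then show ?thesis unfolding V_def by (intro open_sets open_UN) auto
      qed
      have "(\<lambda>n. measure M (V n)) \<longlonglongrightarrow> measure M (\<Union>n. V n)"
      proof (rule finite_Lim_measure_incseq)
        show "range V \<subseteq> sets M" using V_sets by blast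
        show "incseq V" by (fastforce simp: incseq_def V_def)
      qed
      moreover have "(\<Union>n. V n) = U" unfolding V_def using ran \<A> by auto
      ultimately have "(\<lambda>n. measure M (V n)) \<longlonglongrightarrow> measure M U" by simp
      then obtain n where n: "dist (measure M (V n)) (measure M U) < e / 2"
        using \<open>e > 0\<close> unfolding lim_sequentially by (metis half_gt_zero order_refl)
      have VU: "V n \<subseteq> U" unfolding V_def using ran \<A> by auto
      have UV: "measure M (U - V n) < e / 2"
        using n finite_measure_Diff[OF open_sets[OF U(2)] V_sets VU] unfolding dist_real_def
        by linarith
      have "measure M (sym_diff A (V n)) \<le> measure M ((U - A) \<union> (U - V n))"
        using U(1) VU by (intro finite_measure_mono) (use A V_sets open_sets[OF U(2)] in auto)
      also have "\<dots> \<le> measure M (U - A) + measure M (U - V n)"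
        by (intro measure_Un_le) (use A V_sets open_sets[OF U(2)] in auto)
      finally have "measure M (sym_diff A (V n)) < e" using UA UV by linarith
      moreover have "V n \<in> \<C>"
        unfolding \<C>_def V_def by (rule imageI) (use ran \<A> in auto)
      ultimately show ?thesis by blast
    qed
  qed
qed

text \<open>
  Subspaces of separable pseudometric spaces are separable: from each ball of radius
  \<open>1 / (n + 1)\<close> around a point of the dense set, keep one element of the subfamily if there is one.
\<close>

lemma (in finite_measure) countable_dense_subfamily:
  assumes \<C>: "countable \<C>" "\<C> \<subseteq> sets M"
      "\<And>A e. A \<in> sets M \<Longrightarrow> e > 0 \<Longrightarrow> \<exists>C\<in>\<C>. measure M (sym_diff A C) < e"
    and \<F>: "\<F> \<subseteq> sets M"
  obtains \<D> where "countable \<D>" "\<D> \<subseteq> \<F>"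
    "\<And>A e. A \<in> \<F> \<Longrightarrow> e > 0 \<Longrightarrow> \<exists>D\<in>\<D>. measure M (sym_diff A D) < e"
proof -
  define good where "good = (\<lambda>(C, n) A. A \<in> \<F> \<and> measure M (sym_diff A C) < inverse (real (Suc n)))"
  define \<D> where "\<D> = (\<lambda>p. Eps (good p)) ` {p \<in> \<C> \<times> UNIV. \<exists>A. good p A}"
  show thesis
  proof (rule that[of \<D>])
    show "countable \<D>"
    proof -
      have "countable (\<C> \<times> (UNIV :: nat set))" using \<C>(1) by simp
      then have "countable {p \<in> \<C> \<times> UNIV. \<exists>A. good p A}"
        by (rule countable_subset[rotated]) blast
      then show ?thesis unfolding \<D>_def by (rule countable_image)
    qed
    show "\<D> \<subseteq> \<F>"
    proof
      fix D assume "D \<in> \<D>"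
      then obtain p where "D = Eps (good p)" "\<exists>A. good p A" unfolding \<D>_def by blast
      then have "good p D" by (metis someI_ex)
      then show "D \<in> \<F>" by (auto simp: good_def split: prod.splits)
    qed
    fix A and e :: real assume A: "A \<in> \<F>" and "e > 0"
    obtain n where n: "inverse (real (Suc n)) < e / 2"
      using \<open>e > 0\<close> reals_Archimedean[of "e / 2"] by auto
    obtain C where C: "C \<in> \<C>" "measure M (sym_diff A C) < inverse (real (Suc n))"
      using \<C>(3)[of A "inverse (real (Suc n))"] A \<F> by auto
    define D where "D = Eps (good (C, n))"
    have ex: "good (C, n) A" using A C by (simp add: good_def)
    then have "good (C, n) D" unfolding D_def by (rule someI)
    then have D: "D \<in> \<F>" "measure M (sym_diff D C) < inverse (real (Suc n))"
      by (auto simp: good_def)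
    have s: "A \<in> sets M" "C \<in> sets M" "D \<in> sets M" using A C D \<F> \<C> by auto
    have "measure M (sym_diff A D) \<le> measure M (sym_diff A C \<union> sym_diff D C)"
      using s by (intro finite_measure_mono) auto
    also have "\<dots> \<le> measure M (sym_diff A C) + measure M (sym_diff D C)"
      using s by (intro measure_Un_le) auto
    finally have "measure M (sym_diff A D) < e" using n C D by linarith
    moreover have "D \<in> \<D>" unfolding \<D>_def D_def by (rule imageI) (use C ex in auto)
    ultimately show "\<exists>D\<in>\<D>. measure M (sym_diff A D) < e" by blast
  qed
qed

section \<open>The surface measure\<close>

abbreviation \<sigma> :: "'a::euclidean_space measure" where "\<sigma> \<equiv> surface_measure"

lemma finite_measure_surface: "finite_measure (\<sigma> :: 'a::euclidean_space measure)"
  by (rule finite_measureI) (simp add: emeasure_surface_measure_sphere)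

interpretation surface: finite_measure "\<sigma> :: 'a::euclidean_space measure"
  by (rule finite_measure_surface)

lemma measurable_ident_surface: "(\<lambda>v. v) \<in> borel_measurable \<sigma>"
proof -
  have "sets (\<sigma> :: 'a measure) = sets (restrict_space borel (sphere 0 1))"
    by (simp add: surface_measure_def)
  then show ?thesis
    by (subst measurable_cong_sets[OF _ refl])
       (auto intro!: borel_measurable_continuous_on_restrict continuous_on_id)
qed

text \<open>
  The surface measure lives on the sphere only; its push-forward to the whole space is a Borel measure
  to which regularity applies.
\<close>

lemma surface_measure_countable_dense:
  obtains \<C> :: "'a::euclidean_space set set" where "countable \<C>" "\<C> \<subseteq> sets \<sigma>"
    "\<And>A e. A \<in> sets \<sigma> \<Longrightarrow> e > 0 \<Longrightarrow> \<exists>C\<in>\<C>. measure \<sigma> (sym_diff A C) < e"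
proof -
  let ?N = "distr (\<sigma> :: 'a measure) borel (\<lambda>v. v)"
  have N: "measure ?N A = measure \<sigma> (A \<inter> sphere 0 1)" if "A \<in> sets borel" for A
    using that by (subst measure_distr) (auto intro: measurable_ident_surface)
  have "finite_measure ?N"
    by (rule surface.finite_measure_distr[OF measurable_ident_surface])
  then obtain \<C> where \<C>: "countable \<C>" "\<C> \<subseteq> sets ?N"
    "\<And>A e. A \<in> sets ?N \<Longrightarrow> e > 0 \<Longrightarrow> \<exists>C\<in>\<C>. measure ?N (sym_diff A C) < e"
    by (rule countable_dense_borel_sets) auto
  show thesis
  proof (rule that[of "(\<lambda>C. C \<inter> sphere 0 1) ` \<C>"])
    show "(\<lambda>C. C \<inter> sphere 0 1) ` \<C> \<subseteq> sets \<sigma>"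
      using \<C>(2) by (auto simp: sets_surface_measure)
    fix A :: "'a set" and e :: real assume A: "A \<in> sets \<sigma>" and "e > 0"
    then have Ab: "A \<in> sets borel" "A \<subseteq> sphere 0 1" by (auto simp: sets_surface_measure)
    obtain C where C: "C \<in> \<C>" "measure ?N (sym_diff A C) < e"
      using \<C>(3)[of A e] Ab \<open>e > 0\<close> by auto
    have "sym_diff A (C \<inter> sphere 0 1) = sym_diff A C \<inter> sphere 0 1" using Ab by auto
    moreover have "sym_diff A C \<in> sets borel" using Ab C \<C>(2) by auto
    ultimately have "measure \<sigma> (sym_diff A (C \<inter> sphere 0 1)) < e" using C(2) N by metis
    then show "\<exists>C\<in>(\<lambda>C. C \<inter> sphere 0 1) ` \<C>. measure \<sigma> (sym_diff A C) < e" using C(1) by blast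
  qed (use \<C>(1) in simp)
qed

lemma distr_lborel_uminus: "distr lborel borel uminus = (lborel :: 'a::euclidean_space measure)"
  using lborel_affine[of "-1" "0 :: 'a"] by (simp add: density_1)

lemma measurable_uminus_surface: "uminus \<in> measurable (\<sigma> :: 'a::euclidean_space measure) \<sigma>"
proof (rule measurableI)
  fix A :: "'a set" assume A: "A \<in> sets \<sigma>"
  have "uminus -` A \<in> sets (borel :: 'a measure)"
    using measurable_sets[of uminus borel borel A] A by (auto simp: sets_surface_measure)
  then show "uminus -` A \<inter> space \<sigma> \<in> sets \<sigma>"
    by (auto simp: sets_surface_measure)
qed auto

text \<open>
  The antipodal map preserves Lebesgue measure on the ball and commutes with the radial projection
  \<open>sgn\<close>.
\<close>

lemma distr_surface_uminus: "distr \<sigma> \<sigma> uminus = (\<sigma> :: 'a::euclidean_space measure)"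
proof (rule measure_eqI)
  fix A :: "'a set" assume "A \<in> sets (distr \<sigma> \<sigma> uminus)"
  then have A: "A \<in> sets \<sigma>" by simp
  let ?D = "\<lambda>A. {x \<in> ball 0 1 - {0}. sgn x \<in> (A :: 'a set)}"
  have Ab: "A \<in> sets borel" using A by (simp add: sets_surface_measure)
  have [measurable]: "(sgn :: 'a \<Rightarrow> 'a) \<in> borel_measurable borel"
    unfolding sgn_div_norm by measurable
  have D: "?D A \<in> sets borel"
    using Ab by measurable
  have "emeasure (distr \<sigma> \<sigma> uminus) A = emeasure \<sigma> (uminus -` A \<inter> space \<sigma>)"
    by (rule emeasure_distr[OF measurable_uminus_surface A])
  also have "\<dots> = ennreal (real DIM('a)) * emeasure lborel (?D (uminus -` A \<inter> space \<sigma>))"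
    by (rule emeasure_surface_measure) (rule measurable_sets[OF measurable_uminus_surface A])
  also have "?D (uminus -` A \<inter> space \<sigma>) = uminus -` ?D A \<inter> space lborel"
    by (auto simp: sgn_minus norm_sgn)
  also have "emeasure lborel \<dots> = emeasure (distr lborel borel uminus) (?D A)"
    using D by (subst emeasure_distr) auto
  also have "\<dots> = emeasure lborel (?D A)" by (simp add: distr_lborel_uminus)
  also have "ennreal (real DIM('a)) * \<dots> = emeasure \<sigma> A"
    by (rule emeasure_surface_measure[OF A, symmetric])
  finally show "emeasure (distr \<sigma> \<sigma> uminus) A = emeasure \<sigma> A" .
qed simp

lemma uminus_image_surface:
  assumes "A \<in> sets \<sigma>"
  shows "uminus ` A \<in> sets \<sigma>" "measure \<sigma> (uminus ` A) = measure \<sigma> A"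
proof -
  have eq: "uminus ` A = uminus -` A \<inter> space \<sigma>"
    using sets.sets_into_space[OF assms] by (force simp: image_iff)
  show "uminus ` A \<in> sets \<sigma>"
    unfolding eq by (rule measurable_sets[OF measurable_uminus_surface assms])
  show "measure \<sigma> (uminus ` A) = measure \<sigma> A"
    unfolding eq using measure_distr[OF measurable_uminus_surface assms]
    by (simp add: distr_surface_uminus)
qed

lemma mean_on_odd_eq_0:
  fixes f :: "'a::euclidean_space \<Rightarrow> real"
  assumes f: "f \<in> borel_measurable \<sigma>" and odd: "\<And>v. f (- v) = - f v"
    and C: "C \<in> sets \<sigma>" "\<And>v. - v \<in> C \<longleftrightarrow> v \<in> C"
  shows "mean_on \<sigma> C f = 0"
proof -
  have "(LINT v:C|\<sigma>. f v) = (LINT v|distr \<sigma> \<sigma> uminus. indicator C v * f v)"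
    by (simp add: set_lebesgue_integral_def distr_surface_uminus)
  also have "\<dots> = (LINT v|\<sigma>. indicator C (- v) * f (- v))"
    using f C by (intro integral_distr measurable_uminus_surface) auto
  also have "\<dots> = - (LINT v:C|\<sigma>. f v)"
    by (simp add: set_lebesgue_integral_def odd C(2) indicator_def)
  finally show ?thesis by (simp add: mean_on_def)
qed

section \<open>The game value\<close>

text \<open>
  Two sets that each exceed half of the sphere by \<open>\<delta>\<close> overlap in measure at least \<open>2 * \<delta>\<close>, because
  their union is no larger than the sphere.
\<close>

lemma overlapping_family_big_sets:
  assumes "\<epsilon> > 0" "big_sets \<epsilon> \<noteq> ({} :: 'a::euclidean_space set set)"
  shows "overlapping_family (\<sigma> :: 'a measure) (big_sets \<epsilon>) (2 * delta \<epsilon>)"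
proof unfold_locales
  show "2 * delta \<epsilon> > 0" using assms(1) by (simp add: delta_def)
  show "big_sets \<epsilon> \<noteq> ({} :: 'a set set)" by fact
  show sets: "big_sets \<epsilon> \<subseteq> sets (\<sigma> :: 'a measure)" by (auto simp: big_sets_def)
  fix A B :: "'a set" assume AB: "A \<in> big_sets \<epsilon>" "B \<in> big_sets \<epsilon>"
  then have s: "A \<in> sets \<sigma>" "B \<in> sets \<sigma>" using sets by auto
  have "measure \<sigma> (A \<union> B) = measure \<sigma> A + measure \<sigma> B - measure \<sigma> (A \<inter> B)"
    using s by (intro measure_Un3) (auto simp: surface.fmeasurable_eq_sets)
  moreover have "measure \<sigma> (A \<union> B) \<le> measure \<sigma> (sphere (0::'a) 1)"
    using surface.bounded_measure[of "A \<union> B"] by simp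
  ultimately show "2 * delta \<epsilon> \<le> measure \<sigma> (A \<inter> B)"
    using AB unfolding big_sets_def by auto
qed

lemma uminus_image_big_sets: "A \<in> big_sets \<epsilon> \<Longrightarrow> uminus ` A \<in> big_sets \<epsilon>"
  by (auto simp: big_sets_def uminus_image_surface)

lemma game_value_eq_sup_inf_mean:
  "game_value \<epsilon> u x = sup_inf_mean \<sigma> (big_sets \<epsilon>) (\<lambda>v. u (x + \<epsilon> *\<^sub>R v))"
  by (simp add: game_value_def sup_inf_mean_def mean_on_def)

lemma borel_measurable_sphere_section:
  assumes "u \<in> borel_measurable borel"
  shows "(\<lambda>v. u (x + \<epsilon> *\<^sub>R v)) \<in> borel_measurable \<sigma>"
proof -
  note [measurable] = measurable_ident_surface assms
  show ?thesis by measurable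
qed

lemma bounded_measurable_sphere_section:
  assumes "loc_bdd_borel u"
  shows "bounded_measurable \<sigma> (\<lambda>v. u (x + \<epsilon> *\<^sub>R v))"
proof -
  have "bounded ((\<lambda>v. x + \<epsilon> *\<^sub>R v) ` sphere 0 1)"
    by (intro compact_imp_bounded compact_continuous_image continuous_intros) simp
  then have "bounded (u ` (\<lambda>v. x + \<epsilon> *\<^sub>R v) ` sphere 0 1)"
    using assms by (simp add: loc_bdd_borel_def)
  then show ?thesis
    using assms borel_measurable_sphere_section
    by (auto simp: bounded_measurable_def loc_bdd_borel_def image_image)
qed

lemma loc_bdd_borelI:
  assumes "u \<in> borel_measurable borel" "\<And>x. \<bar>u x\<bar> \<le> C"
  shows "loc_bdd_borel u"
  using assms unfolding loc_bdd_borel_def bounded_iff by auto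

text \<open>
  For two fixed sets the average is Borel in the centre \<open>x\<close> by Fubini, and only countably many sets
  matter.
\<close>

lemma borel_measurable_game_value:
  fixes u :: "'a::euclidean_space \<Rightarrow> real"
  assumes "\<epsilon> > 0" "big_sets \<epsilon> \<noteq> ({} :: 'a set set)" and u: "loc_bdd_borel u"
  shows "game_value \<epsilon> u \<in> borel_measurable borel"
proof -
  interpret overlapping_family "\<sigma> :: 'a measure" "big_sets \<epsilon>" "2 * delta \<epsilon>"
    by (rule overlapping_family_big_sets) fact+
  obtain \<C> :: "'a set set" where \<C>: "countable \<C>" "\<C> \<subseteq> sets \<sigma>"
    "\<And>A e. A \<in> sets \<sigma> \<Longrightarrow> e > 0 \<Longrightarrow> \<exists>C\<in>\<C>. measure \<sigma> (sym_diff A C) < e"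
    using surface_measure_countable_dense by metis
  obtain \<D> :: "'a set set" where \<D>: "countable \<D>" "\<D> \<subseteq> big_sets \<epsilon>"
    and dense: "\<And>A e. A \<in> big_sets \<epsilon> \<Longrightarrow> e > 0 \<Longrightarrow> \<exists>D\<in>\<D>. measure \<sigma> (sym_diff A D) < e"
    by (rule surface.countable_dense_subfamily[OF \<C>(1,2) _ sets]) (use \<C>(3) in auto)
  have ne: "\<D> \<noteq> {}"
    using nonempty dense[OF _ zero_less_one] by blast
  let ?m = "\<lambda>A B x. mean_on \<sigma> (A \<inter> B) (\<lambda>v. u (x + \<epsilon> *\<^sub>R v))"
  have meas: "?m A B \<in> borel_measurable borel" if "A \<in> \<D>" "B \<in> \<D>" for A B
  proof -
    have s: "A \<inter> B \<in> sets \<sigma>" using that \<D> by (intro inter_sets) auto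
    note [measurable] = measurable_ident_surface
    have [measurable]: "u \<in> borel_measurable borel" using u by (simp add: loc_bdd_borel_def)
    have [measurable]: "indicat_real (A \<inter> B) \<in> borel_measurable \<sigma>" using s by simp
    have "(\<lambda>(x, v). indicat_real (A \<inter> B) v *\<^sub>R u (x + \<epsilon> *\<^sub>R v)) \<in> borel_measurable (borel \<Otimes>\<^sub>M \<sigma>)"
      by measurable
    then show ?thesis
      unfolding mean_on_def set_lebesgue_integral_def
      by (intro borel_measurable_times borel_measurable_const
        surface.borel_measurable_lebesgue_integral)
  qed
  have "game_value \<epsilon> u = (\<lambda>x. SUP A\<in>\<D>. INF B\<in>\<D>. ?m A B x)"
    using sup_inf_mean_dense[OF bounded_measurable_sphere_section[OF u] \<D>(2) ne dense]
    by (simp add: fun_eq_iff game_value_eq_sup_inf_mean sup_inf_mean_def)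
  also have "\<dots> \<in> borel_measurable borel"
  proof (rule borel_measurable_cSUP[OF \<D>(1)])
    show "(\<lambda>x. INF B\<in>\<D>. ?m A B x) \<in> borel_measurable borel" if "A \<in> \<D>" for A
      using \<D>(1) meas that by (intro borel_measurable_cINF_real) auto
    fix x
    have f: "bounded_measurable \<sigma> (\<lambda>v. u (x + \<epsilon> *\<^sub>R v))"
      by (rule bounded_measurable_sphere_section[OF u])
    obtain b where b: "\<And>v. v \<in> space (\<sigma> :: 'a measure) \<Longrightarrow> \<bar>u (x + \<epsilon> *\<^sub>R v)\<bar> \<le> b"
      using bounded_measurableE[OF f] by metis
    have m: "\<bar>?m A B x\<bar> \<le> b" if "A \<in> \<D>" "B \<in> \<D>" for A B
      by (rule abs_mean_on_inter_le[OF f b]) (use that \<D>(2) in auto)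
    obtain B where B: "B \<in> \<D>" using ne by blast
    have "(INF B\<in>\<D>. ?m A B x) \<le> b" if A: "A \<in> \<D>" for A
    proof -
      have "bdd_below ((\<lambda>B. ?m A B x) ` \<D>)"
        using m[OF A] by (intro bdd_belowI2[where m = "- b"]) (auto simp: abs_le_iff minus_le_iff)
      then have "(INF B\<in>\<D>. ?m A B x) \<le> ?m A B x" using B by (rule cINF_lower)
      then show ?thesis using m[OF A B] by linarith
    qed
    then show "bdd_above ((\<lambda>A. INF B\<in>\<D>. ?m A B x) ` \<D>)" by (rule bdd_aboveI2)
  qed
  finally show ?thesis .
qed

lemma game_value_le_affine:
  fixes u w :: "'a::euclidean_space \<Rightarrow> real"
  assumes "\<epsilon> > 0" "big_sets \<epsilon> \<noteq> ({} :: 'a set set)" "loc_bdd_borel u" "loc_bdd_borel w" "l > 0"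
    and "\<And>v. norm v = 1 \<Longrightarrow> u (x + \<epsilon> *\<^sub>R v) \<le> l * w (x + \<epsilon> *\<^sub>R v) + c"
  shows "game_value \<epsilon> u x \<le> l * game_value \<epsilon> w x + c"
proof -
  interpret overlapping_family "\<sigma> :: 'a measure" "big_sets \<epsilon>" "2 * delta \<epsilon>"
    by (rule overlapping_family_big_sets) fact+
  show ?thesis
    unfolding game_value_eq_sup_inf_mean
    using assms by (intro sup_inf_mean_le_affine bounded_measurable_sphere_section) auto
qed

lemma game_value_zero:
  assumes "big_sets \<epsilon> \<noteq> ({} :: 'a::euclidean_space set set)"
  shows "game_value \<epsilon> (\<lambda>_. 0) (x :: 'a) = 0"
  using assms by (simp add: game_value_def set_lebesgue_integral_def)

text \<open>
  Against \<open>A\<close> the minimising player plays \<open>- A\<close>. The average of \<open>x \<bullet> v\<close> over the symmetric set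
  \<open>A \<inter> - A\<close> vanishes, and of \<open>|x + \<epsilon> v|\<^sup>2 = |x|\<^sup>2 + 2 \<epsilon> (x \<bullet> v) + \<epsilon>\<^sup>2\<close> only \<open>|x|\<^sup>2 + \<epsilon>\<^sup>2\<close> remains.
\<close>

lemma game_value_paraboloid_le:
  fixes x :: "'a::euclidean_space"
  assumes "\<epsilon> > 0" "big_sets \<epsilon> \<noteq> ({} :: 'a set set)"
  shows "game_value \<epsilon> (\<lambda>y. C - K * (norm y)\<^sup>2) x \<le> C - K * (norm x)\<^sup>2 - \<epsilon>\<^sup>2 * K"
proof -
  interpret overlapping_family "\<sigma> :: 'a measure" "big_sets \<epsilon>" "2 * delta \<epsilon>"
    by (rule overlapping_family_big_sets) fact+
  let ?f = "\<lambda>v. C - K * (norm (x + \<epsilon> *\<^sub>R v))\<^sup>2"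
  have "(\<lambda>y. C - K * (norm y)\<^sup>2) \<in> borel_measurable borel" by measurable
  then have "?f \<in> borel_measurable \<sigma>" by (rule borel_measurable_sphere_section)
  moreover have "\<bar>?f v\<bar> \<le> \<bar>C\<bar> + \<bar>K\<bar> * (norm x + \<epsilon>)\<^sup>2" if "norm v = 1" for v
  proof -
    have "norm (x + \<epsilon> *\<^sub>R v) \<le> norm x + \<epsilon>"
      using norm_triangle_ineq[of x "\<epsilon> *\<^sub>R v"] that \<open>\<epsilon> > 0\<close> by simp
    then have "\<bar>K\<bar> * (norm (x + \<epsilon> *\<^sub>R v))\<^sup>2 \<le> \<bar>K\<bar> * (norm x + \<epsilon>)\<^sup>2"
      by (intro mult_left_mono power_mono) auto
    then show ?thesis
      using abs_triangle_ineq4[of C "K * (norm (x + \<epsilon> *\<^sub>R v))\<^sup>2"] by (simp add: abs_mult)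
  qed
  ultimately have f: "bounded_measurable \<sigma> ?f"
    by (intro bounded_measurableI) auto
  have g: "bounded_measurable \<sigma> (\<lambda>v. x \<bullet> v)"
  proof (rule bounded_measurableI)
    show "(\<lambda>v. x \<bullet> v) \<in> borel_measurable \<sigma>"
      using measurable_ident_surface by measurable
    show "\<bar>x \<bullet> v\<bar> \<le> norm x" if "v \<in> space \<sigma>" for v
      using Cauchy_Schwarz_ineq2[of x v] that by simp
  qed
  obtain b where b: "\<And>v. v \<in> space (\<sigma> :: 'a measure) \<Longrightarrow> \<bar>?f v\<bar> \<le> b"
    using f by (metis bounded_measurableE)
  have "(INF B\<in>big_sets \<epsilon>. mean_on \<sigma> (A \<inter> B) ?f) \<le> C - K * (norm x)\<^sup>2 - \<epsilon>\<^sup>2 * K"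
    if A: "A \<in> big_sets \<epsilon>" for A
  proof -
    let ?B = "uminus ` A"
    have B: "?B \<in> big_sets \<epsilon>" using A by (rule uminus_image_big_sets)
    have "mean_on \<sigma> (A \<inter> ?B) ?f
        \<le> (- 2 * K * \<epsilon>) * mean_on \<sigma> (A \<inter> ?B) (\<lambda>v. x \<bullet> v) + (C - K * (norm x)\<^sup>2 - \<epsilon>\<^sup>2 * K)"
    proof (rule surface.mean_on_le_affine[OF f g inter_sets[OF A B] inter_pos[OF A B]])
      fix v assume "v \<in> A \<inter> ?B"
      then have "norm v = 1"
        using sets.sets_into_space[OF inter_sets[OF A B]] by auto
      then have "(norm (x + \<epsilon> *\<^sub>R v))\<^sup>2 = (norm x)\<^sup>2 + 2 * \<epsilon> * (x \<bullet> v) + \<epsilon>\<^sup>2"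
        unfolding power2_norm_eq_inner
        by (simp add: inner_add_left inner_add_right inner_commute power2_eq_square norm_eq_1 algebra_simps)
      then show "?f v \<le> (- 2 * K * \<epsilon>) * (x \<bullet> v) + (C - K * (norm x)\<^sup>2 - \<epsilon>\<^sup>2 * K)"
        by (simp add: algebra_simps)
    qed
    also have "mean_on \<sigma> (A \<inter> ?B) (\<lambda>v. x \<bullet> v) = 0"
    proof (rule mean_on_odd_eq_0[OF _ _ inter_sets[OF A B]])
      show "(\<lambda>v. x \<bullet> v) \<in> borel_measurable \<sigma>" using g by (simp add: bounded_measurable_def)
      show "- v \<in> A \<inter> ?B \<longleftrightarrow> v \<in> A \<inter> ?B" for v
        by (auto simp: image_iff) (metis minus_minus)+
    qed simp
    finally have "mean_on \<sigma> (A \<inter> ?B) ?f \<le> C - K * (norm x)\<^sup>2 - \<epsilon>\<^sup>2 * K" by simp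
    moreover have "bdd_below ((\<lambda>B. mean_on \<sigma> (A \<inter> B) ?f) ` big_sets \<epsilon>)"
      using abs_mean_on_inter_le[OF f b A]
      by (intro bdd_belowI2[where m = "- b"]) (auto simp: abs_le_iff minus_le_iff)
    ultimately show ?thesis
      by (meson B cINF_lower order_trans)
  qed
  then show ?thesis
    unfolding game_value_eq_sup_inf_mean sup_inf_mean_def
    by (intro cSUP_least nonempty)
qed

section \<open>Comparison and existence\<close>

text \<open>
  The value is not linear, so the difference of \<open>u\<close> and \<open>w\<close> satisfies no useful inequality, and there
  is no continuity that would let a supremum be attained. Scaling \<open>w\<close> by \<open>l > 1\<close> gives a strict
  supersolution by homogeneity, and the margin \<open>\<eta>\<close> gained in each step replaces both.
\<close>

lemma comparison:
  fixes \<Omega> :: "'a::euclidean_space set"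
  assumes "\<epsilon> > 0" "K > 0" "bounded \<Omega>"
    and w: "supersolution \<epsilon> K \<Omega> w" and u: "subsolution \<epsilon> K \<Omega> u"
  shows "u x \<le> w x"
proof (cases "big_sets \<epsilon> = ({} :: 'a set set)")
  case True
  then have "game_value \<epsilon> u x = game_value \<epsilon> w x" by (simp add: game_value_def)
  then show ?thesis
    using w u unfolding supersolution_def subsolution_def by (cases "x \<in> \<Omega>") force+
next
  case False
  have lu: "loc_bdd_borel u" and lw: "loc_bdd_borel w"
    using w u by (auto simp: supersolution_def subsolution_def)
  have u_out: "\<And>x. x \<notin> \<Omega> \<Longrightarrow> u x \<le> 0" and w_out: "\<And>x. x \<notin> \<Omega> \<Longrightarrow> 0 \<le> w x"
    and u_in: "\<And>x. x \<in> \<Omega> \<Longrightarrow> u x \<le> game_value \<epsilon> u x + \<epsilon>\<^sup>2 * K"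
    and w_in: "\<And>x. x \<in> \<Omega> \<Longrightarrow> game_value \<epsilon> w x + \<epsilon>\<^sup>2 * K \<le> w x"
    using w u by (auto simp: supersolution_def subsolution_def)
  obtain a b where ab: "\<And>y. y \<in> \<Omega> \<Longrightarrow> \<bar>u y\<bar> \<le> a" "\<And>y. y \<in> \<Omega> \<Longrightarrow> \<bar>w y\<bar> \<le> b"
    using lu lw \<open>bounded \<Omega>\<close> unfolding loc_bdd_borel_def bounded_iff by (metis image_eqI real_norm_def)
  have scaled: "u x \<le> l * w x" if "l > 1" for l
  proof -
    define \<eta> where "\<eta> = (l - 1) * (\<epsilon>\<^sup>2 * K)"
    have \<eta>: "\<eta> > 0" using that assms by (simp add: \<eta>_def)
    define c where "c = \<bar>a\<bar> + l * \<bar>b\<bar>"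
    have step: "u y \<le> l * w y + max 0 (c - real n * \<eta>)" for n y
    proof (induction n arbitrary: y)
      case 0
      show ?case
      proof (cases "y \<in> \<Omega>")
        case True
        have "- (l * w y) \<le> l * \<bar>b\<bar>"
          using ab(2)[OF True] that mult_left_mono[of "- w y" "\<bar>b\<bar>" l] by auto
        then show ?thesis using ab(1)[OF True] by (simp add: c_def)
      next
        case False
        have "0 \<le> l * w y" using w_out[OF False] that by simp
        then show ?thesis using u_out[OF False] by linarith
      qed
    next
      case (Suc n)
      show ?case
      proof (cases "y \<in> \<Omega>")
        case True
        have "game_value \<epsilon> u y \<le> l * game_value \<epsilon> w y + max 0 (c - real n * \<eta>)"
          using Suc.IH that by (intro game_value_le_affine \<open>\<epsilon> > 0\<close> False lu lw) auto
        moreover have "l * (game_value \<epsilon> w y + \<epsilon>\<^sup>2 * K) \<le> l * w y"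
          using w_in[OF True] that by (intro mult_left_mono) auto
        ultimately have "u y \<le> l * w y + max 0 (c - real n * \<eta>) - \<eta>"
          using u_in[OF True] unfolding \<eta>_def by (simp add: algebra_simps)
        then show ?thesis using \<eta> by (auto simp: algebra_simps max_def split: if_splits)
      next
        case False
        have "0 \<le> l * w y" using w_out[OF False] that by simp
        then show ?thesis using u_out[OF False] by linarith
      qed
    qed
    obtain n where "c < real n * \<eta>" using reals_Archimedean3[OF \<eta>] by blast
    then show ?thesis using step[of x n] by simp
  qed
  have "((\<lambda>l. l * w x) \<longlongrightarrow> 1 * w x) (at_right 1)"
    by (intro tendsto_intros)
  then have "u x \<le> 1 * w x"
    by (rule tendsto_lowerbound)
       (use scaled in \<open>auto simp: eventually_at_right_less eventually_at_filter\<close>)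
  then show ?thesis by simp
qed

text \<open>
  The limit of the increasing iteration from 0. The barrier is needed only where the game can go in
  one step, the ball of radius \<open>R + \<epsilon>\<close>; it is nonnegative there by the choice of \<open>C\<close>, but negative
  far away, where the iterates vanish.
\<close>

lemma solution_exists:
  fixes \<Omega> :: "'a::euclidean_space set"
  assumes "\<epsilon> > 0" "K > 0" "bounded \<Omega>" and \<Omega>: "\<Omega> \<in> sets borel"
  shows "\<exists>u. solution \<epsilon> K \<Omega> u"
proof (cases "big_sets \<epsilon> = ({} :: 'a set set)")
  case True
  define s :: real where "s = Sup {}"
  define u where "u x = (if x \<in> \<Omega> then s + \<epsilon>\<^sup>2 * K else 0)" for x
  have "loc_bdd_borel u"
  proof (rule loc_bdd_borelI)
    show "u \<in> borel_measurable borel" unfolding u_def using \<Omega> by measurable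
    show "\<bar>u x\<bar> \<le> \<bar>s + \<epsilon>\<^sup>2 * K\<bar>" for x by (simp add: u_def)
  qed
  moreover have "game_value \<epsilon> u x = s" for x using True by (simp add: game_value_def s_def)
  ultimately have "solution \<epsilon> K \<Omega> u" by (simp add: solution_def u_def)
  then show ?thesis by blast
next
  case False
  interpret overlapping_family "\<sigma> :: 'a measure" "big_sets \<epsilon>" "2 * delta \<epsilon>"
    by (rule overlapping_family_big_sets) fact+
  note gv_le = game_value_le_affine[OF \<open>\<epsilon> > 0\<close> False]
  obtain R where R: "R > 0" "\<And>x. x \<in> \<Omega> \<Longrightarrow> norm x \<le> R"
    using \<open>bounded \<Omega>\<close> by (auto simp: bounded_pos)
  define C where "C = K * (R + \<epsilon>)\<^sup>2"
  have C_nonneg: "C \<ge> 0" using \<open>K > 0\<close> by (simp add: C_def)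
  define barrier where "barrier x = C - K * (norm x)\<^sup>2" for x :: 'a
  have barrier_lb: "loc_bdd_borel barrier"
    unfolding loc_bdd_borel_def barrier_def
  proof safe
    show "(\<lambda>x. C - K * (norm x)\<^sup>2) \<in> borel_measurable borel" by measurable
    fix S :: "'a set" assume "bounded S"
    then have "compact (closure S)" by simp
    then have "bounded ((\<lambda>x. C - K * (norm x)\<^sup>2) ` closure S)"
      by (intro compact_imp_bounded compact_continuous_image continuous_intros)
    then show "bounded ((\<lambda>x. C - K * (norm x)\<^sup>2) ` S)"
      by (rule bounded_subset) (use closure_subset in blast)
  qed
  define step where "step u x = (if x \<in> \<Omega> then game_value \<epsilon> u x + \<epsilon>\<^sup>2 * K else 0)" for u x
  define it where "it n = (step ^^ n) (\<lambda>_. 0)" for n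
  have it_Suc: "it (Suc n) = step (it n)" for n by (simp add: it_def)
  define inv where "inv u \<longleftrightarrow> u \<in> borel_measurable borel \<and> (\<forall>x. 0 \<le> u x)
      \<and> (\<forall>x. x \<notin> \<Omega> \<longrightarrow> u x = 0) \<and> (\<forall>x. norm x \<le> R + \<epsilon> \<longrightarrow> u x \<le> barrier x)" for u
  have barrier_le: "barrier x \<le> C" for x using \<open>K > 0\<close> by (simp add: barrier_def)
  have inv_bound: "\<bar>u x\<bar> \<le> C" if "inv u" for u x
  proof (cases "x \<in> \<Omega>")
    case True
    then have "u x \<le> barrier x" using that R(2)[OF True] \<open>\<epsilon> > 0\<close> unfolding inv_def by auto
    then show ?thesis using that barrier_le[of x] unfolding inv_def by (metis abs_of_nonneg order_trans)
  next
    case False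
    then show ?thesis using that C_nonneg by (simp add: inv_def)
  qed
  have inv_lb: "loc_bdd_borel u" if "inv u" for u
    using inv_bound[OF that] that by (intro loc_bdd_borelI) (auto simp: inv_def)
  have inv_step: "inv (step u)" if u: "inv u" for u
    unfolding inv_def
  proof (intro conjI allI impI)
    have [measurable]: "game_value \<epsilon> u \<in> borel_measurable borel"
      by (rule borel_measurable_game_value[OF \<open>\<epsilon> > 0\<close> False inv_lb[OF u]])
    show "step u \<in> borel_measurable borel" unfolding step_def using \<Omega> by measurable
    fix x
    show "x \<notin> \<Omega> \<Longrightarrow> step u x = 0" by (simp add: step_def)
    have "game_value \<epsilon> (\<lambda>_. 0) x \<le> 1 * game_value \<epsilon> u x + 0"
      using u by (intro gv_le inv_lb[OF u] loc_bdd_borelI[where C = 0]) (auto simp: inv_def)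
    then show "0 \<le> step u x"
      using \<open>K > 0\<close> by (simp add: step_def game_value_zero[OF False])
    assume x: "norm x \<le> R + \<epsilon>"
    show "step u x \<le> barrier x"
    proof (cases "x \<in> \<Omega>")
      case True
      have "game_value \<epsilon> u x \<le> 1 * game_value \<epsilon> barrier x + 0"
      proof (rule gv_le[OF inv_lb[OF u] barrier_lb])
        fix v :: 'a assume "norm v = 1"
        then have "norm (x + \<epsilon> *\<^sub>R v) \<le> R + \<epsilon>"
          using norm_triangle_ineq[of x "\<epsilon> *\<^sub>R v"] R(2)[OF True] \<open>\<epsilon> > 0\<close> by simp
        then show "u (x + \<epsilon> *\<^sub>R v) \<le> 1 * barrier (x + \<epsilon> *\<^sub>R v) + 0"
          using u by (simp add: inv_def)
      qed simp
      also have "game_value \<epsilon> barrier x \<le> barrier x - \<epsilon>\<^sup>2 * K"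
        unfolding barrier_def by (rule game_value_paraboloid_le[OF \<open>\<epsilon> > 0\<close> False])
      finally show ?thesis using True by (simp add: step_def)
    next
      case False
      have "K * (norm x)\<^sup>2 \<le> C"
        unfolding C_def using x \<open>K > 0\<close> by (intro mult_left_mono power_mono) auto
      then show ?thesis using False by (simp add: step_def barrier_def)
    qed
  qed
  have inv0: "inv (\<lambda>_. 0)"
    unfolding inv_def
  proof (intro conjI allI impI)
    fix x :: 'a assume "norm x \<le> R + \<epsilon>"
    then have "K * (norm x)\<^sup>2 \<le> C"
      unfolding C_def using \<open>K > 0\<close> by (intro mult_left_mono power_mono) auto
    then show "0 \<le> barrier x" by (simp add: barrier_def)
  qed auto
  have inv_it: "inv (it n)" for n
    by (induction n) (use inv0 inv_step in \<open>auto simp: it_def\<close>)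
  have mono: "it n x \<le> it (Suc n) x" for n x
  proof (induction n arbitrary: x)
    case 0
    show ?case using inv_it[of "Suc 0"] by (simp add: it_def inv_def)
  next
    case (Suc n)
    have "game_value \<epsilon> (it n) x \<le> 1 * game_value \<epsilon> (it (Suc n)) x + 0"
      using Suc.IH by (intro gv_le inv_lb inv_it) auto
    then show ?case by (simp add: it_Suc[of n] it_Suc[of "Suc n"] step_def)
  qed
  have "\<exists>u. \<forall>x. (\<lambda>n. it n x) \<longlonglongrightarrow> u x"
  proof (intro choice allI)
    fix x
    have "incseq (\<lambda>n. it n x)" using mono by (intro incseq_SucI)
    then show "\<exists>y. (\<lambda>n. it n x) \<longlonglongrightarrow> y"
      using inv_bound[OF inv_it] by (metis abs_le_D1 incseq_convergent)
  qed
  then obtain u where lim: "\<And>x. (\<lambda>n. it n x) \<longlonglongrightarrow> u x" by blast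
  have it_meas: "it n \<in> borel_measurable borel" for n using inv_it by (simp add: inv_def)
  have "loc_bdd_borel u"
  proof (rule loc_bdd_borelI)
    show "u \<in> borel_measurable borel"
      by (rule borel_measurable_LIMSEQ_real[OF lim it_meas])
    show "\<bar>u x\<bar> \<le> C" for x
      by (rule LIMSEQ_le_const2[OF tendsto_rabs[OF lim]]) (use inv_bound[OF inv_it] in auto)
  qed
  moreover have "u x = 0" if "x \<notin> \<Omega>" for x
  proof -
    have "(\<lambda>n. it n x) = (\<lambda>_. 0)" using inv_it that by (auto simp: inv_def)
    then show ?thesis using lim[of x] by (simp add: LIMSEQ_const_iff)
  qed
  moreover have "u x = game_value \<epsilon> u x + \<epsilon>\<^sup>2 * K" if "x \<in> \<Omega>" for x
  proof -
    have "(\<lambda>n. game_value \<epsilon> (it n) x) \<longlonglongrightarrow> game_value \<epsilon> u x"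
      unfolding game_value_eq_sup_inf_mean
      by (rule tendsto_sup_inf_mean[where b = C])
         (auto intro: borel_measurable_sphere_section it_meas inv_bound[OF inv_it] lim)
    then have "(\<lambda>n. it (Suc n) x) \<longlonglongrightarrow> game_value \<epsilon> u x + \<epsilon>\<^sup>2 * K"
      using that by (auto simp: it_Suc step_def intro!: tendsto_intros)
    moreover have "(\<lambda>n. it (Suc n) x) \<longlonglongrightarrow> u x" by (rule LIMSEQ_Suc[OF lim])
    ultimately show ?thesis by (rule LIMSEQ_unique[rotated])
  qed
  ultimately show ?thesis unfolding solution_def by blast
qed

theorem theorem1p1:
  fixes \<Omega>\<^sub>0 :: "'a::euclidean_space set" and K \<epsilon> :: real
  assumes "DIM('a) \<ge> 2"
    and "open \<Omega>\<^sub>0" and "connected \<Omega>\<^sub>0" and "\<Omega>\<^sub>0 \<noteq> {}"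
    and "bounded \<Omega>\<^sub>0" and "strictly_convex \<Omega>\<^sub>0"
    and "K > 0" and "\<epsilon> > 0"
  shows "(\<exists>!u. solution \<epsilon> K \<Omega>\<^sub>0 u) \<and>
         (\<forall>u_super u_sub. supersolution \<epsilon> K \<Omega>\<^sub>0 u_super \<longrightarrow> subsolution \<epsilon> K \<Omega>\<^sub>0 u_sub \<longrightarrow>
            (\<forall>x. u_super x \<ge> u_sub x))"
proof -
  note compare = comparison[OF \<open>\<epsilon> > 0\<close> \<open>K > 0\<close> \<open>bounded \<Omega>\<^sub>0\<close>]
  have "\<exists>u. solution \<epsilon> K \<Omega>\<^sub>0 u"
    using assms by (intro solution_exists) auto
  moreover have "u = w" if "solution \<epsilon> K \<Omega>\<^sub>0 u" "solution \<epsilon> K \<Omega>\<^sub>0 w" for u w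
  proof
    have "supersolution \<epsilon> K \<Omega>\<^sub>0 z" "subsolution \<epsilon> K \<Omega>\<^sub>0 z" if "solution \<epsilon> K \<Omega>\<^sub>0 z" for z
      using that by (auto simp: solution_def supersolution_def subsolution_def)
    with that show "u x = w x" for x
      by (intro antisym compare) auto
  qed
  ultimately show ?thesis using compare by blast
qed

end
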